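(* Let $b\ge2$ be an integer and let $\mathcal{D}\subset\mathbb{Z}$ be a finite set with $\#\mathcal{D}=b$, $0\in\mathcal{D}$ and $\gcd(\mathcal{D})=1$. Then $T(b,\mathcal{D})$ is a self-similar tile if and only if there exists an integer $m\ge 1$ such that $\mathcal{D}_m=\mathcal{D}+b\mathcal{D}+\cdots+b^{m-1}\mathcal{D}$ is a skew-product-form digit set with respect to $b^m$.
   Context: For an integer $b\ge 2$ and a finite set $\mathcal{D}\subset\mathbb{Z}$ with $\#\mathcal{D}=b$, $T(b,\mathcal{D})$ denotes the unique non-empty compact set $T\subset\mathbb{R}$ satisfying $T=\bigcup_{d\in\mathcal{D}}b^{-1}(T+d)$. It is called a self-similar tile if it has non-empty interior. $\gcd(\mathcal{D})$ is the greatest common divisor of the elements of $\mathcal{D}$. A complete residue set modulo $N$ is a set of $N$ integers, pairwise incongruent modulo $N$. $\mathcal{A}\oplus\mathcal{B}$ denotes the sumset $\mathcal{A}+\mathcal{B}$ when all sums $a+b$ ($a\in\mathcal{A}$, $b\in\mathcal{B}$) are distinct. For an integer $N\ge2$, a set $\mathcal{E}\subset\mathbb{Z}$ with $\#\mathcal{E}=N$ is a skew-product-form digit set with respect to $N$ if there exist $\mathcal{A}=\{a_j\}_{j=0}^{s-1}\subset\mathbb{Z}$ (with $s$ distinct elements) and $\mathcal{B}_0,\dots,\mathcal{B}_{s-1}\subset\mathbb{Z}$ such that $\mathcal{E}=\bigcup_{j=0}^{s-1}(a_j+N\mathcal{B}_j)$ and, for each $j$, the sum $\mathcal{A}+\mathcal{B}_j$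 is direct and $\mathcal{A}\oplus\mathcal{B}_j$ is a complete residue set modulo $N$. *)

theory Defs
  imports "HOL-Analysis.Analysis" "HOL-Library.Set_Algebras"
begin

text \<open>The definite description is meaningful for \<open>b \<ge> 2\<close> and finite non-empty \<open>D\<close>: the maps
  \<open>x \<mapsto> (x + d) / b\<close> are then finitely many contractions, and their attractor is unique.\<close>

definition attractor :: "nat \<Rightarrow> int set \<Rightarrow> real set"
  where "attractor b D =
    (THE T. compact T \<and> T \<noteq> {} \<and> T = (\<Union>d\<in>D. (\<lambda>x. (x + of_int d) / of_nat b) ` T))"

definition self_similar_tile :: "real set \<Rightarrow> bool"
  where "self_similar_tile T \<longleftrightarrow> interior T \<noteq> {}"

definition complete_residue_set :: "nat \<Rightarrow> int set \<Rightarrow> bool"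
  where "complete_residue_set N R \<longleftrightarrow>
    finite R \<and> card R = N \<and> (\<forall>x\<in>R. \<forall>y\<in>R. x \<noteq> y \<longrightarrow> x mod int N \<noteq> y mod int N)"

definition direct_sum :: "int set \<Rightarrow> int set \<Rightarrow> bool"
  where "direct_sum A B \<longleftrightarrow> inj_on (\<lambda>(x, y). x + y) (A \<times> B)"

definition skew_product_form :: "nat \<Rightarrow> int set \<Rightarrow> bool"
  where "skew_product_form N E \<longleftrightarrow>
    finite E \<and> card E = N \<and>
    (\<exists>(s::nat) (a :: nat \<Rightarrow> int) (B :: nat \<Rightarrow> int set).
       inj_on a {..<s} \<and>
       E = (\<Union>j<s. a j +o (int N *o B j)) \<and>
       (\<forall>j<s. direct_sum (a ` {..<s}) (B j) \<and>
              complete_residue_set N (a ` {..<s} + B j)))"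

definition iterated_digits :: "nat \<Rightarrow> int set \<Rightarrow> nat \<Rightarrow> int set"
  where "iterated_digits b D m = (\<Sum>i<m. (int b ^ i) *o D)"

end

theory Submission
  imports Defs
begin

text \<open>
  Write \<open>D\<^sub>m\<close> for the set of digit sums of length \<open>m\<close>, and \<open>T\<close> for the attractor, so that
  \<open>b\<^sup>m T = T + D\<^sub>m\<close> for all \<open>m\<close>.

  A skew-product form makes every integer expandable: its complete residue sets \<open>A \<oplus> B\<^sub>j\<close> allow
  digits to be split off one at a time, with a carry that stays bounded
  (\<open>skew_product_form_expansion\<close>).  Finitely many translates of \<open>T\<close> therefore cover an interval,
  and one of them has interior (\<open>skew_product_form_interior\<close>).

  Conversely, let \<open>T\<close> have interior.  Some periodic digit expansion represents an interior point;
  taking it as the origin and passing to a power \<open>N\<close> of \<open>b\<close> gives a set \<open>S\<close> with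
  \<open>N S = S + E\<close>, \<open>0 \<in> E\<close>, \<open>gcd E = 1\<close> and \<open>0\<close> interior to \<open>S\<close> (\<open>tile_centered\<close>).  Let \<open>J\<close> be the
  union of the sets \<open>E\<^sub>n\<close>.  Comparing measures in \<open>N\<^sup>n S = S + E\<^sub>n\<close> shows that digit expansions
  are unique and that the translates of \<open>S\<close> by \<open>J\<close> do not overlap; since \<open>N\<^sup>n S\<close> exhausts the
  line, they tile it.  Tilings of the line by integer translates of \<open>S\<close> are rigid: a sufficiently
  long window determines the tiling (\<open>tiling_determined_by_window\<close>).  For large \<open>n\<close> the tile
  \<open>N\<^sup>n S\<close> contains such a window around \<open>0\<close>, and the same pattern \<open>E\<^sub>n\<close> recurs in \<open>J\<close> at each
  \<open>N\<^sup>n j\<close> with \<open>j \<in> J\<close>.  Hence each \<open>N\<^sup>n j\<close> is a period of \<open>J\<close> (\<open>J_periods\<close>), and as \<open>gcd E = 1\<close> the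
  number \<open>M = N\<^sup>n\<close> itself is one.  Now \<open>J = A \<oplus> M \<int>\<close> and \<open>J = E\<^sub>n \<oplus> M J\<close>; reading the second
  equation in one residue class \<open>a\<^sub>j + M \<int>\<close> gives \<open>\<int> = B\<^sub>j \<oplus> A \<oplus> M \<int>\<close>, which is the skew-product
  form of \<open>E\<^sub>n\<close> (\<open>digits_skew_product_form\<close>).  Finally \<open>E\<^sub>n\<close> is a translate of some \<open>D\<^sub>m\<close>, and
  translating a digit set by an integer preserves its skew-product form.
\<close>

section \<open>Iterated digit sets\<close>

lemma iterated_digits_0 [simp]: "iterated_digits b D 0 = {0}"
  by (simp add: iterated_digits_def)

lemma iterated_digits_Suc:
  "iterated_digits b D (Suc n) = {e + int b ^ n * d | e d. e \<in> iterated_digits b D n \<and> d \<in> D}"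
  by (auto simp: iterated_digits_def set_plus_def elt_set_times_def)

lemma iterated_digits_add:
  "iterated_digits b D (m + n) =
     {x + int b ^ m * y | x y. x \<in> iterated_digits b D m \<and> y \<in> iterated_digits b D n}"
proof (induction n)
  case 0
  then show ?case by simp
next
  case (Suc n)
  have "iterated_digits b D (m + Suc n) =
      {(x + int b ^ m * y) + int b ^ (m + n) * d | x y d.
        x \<in> iterated_digits b D m \<and> y \<in> iterated_digits b D n \<and> d \<in> D}"
    by (auto simp: iterated_digits_Suc Suc; metis)
  also have "\<dots> = {x + int b ^ m * (y + int b ^ n * d) | x y d.
        x \<in> iterated_digits b D m \<and> y \<in> iterated_digits b D n \<and> d \<in> D}"
    by (simp add: algebra_simps power_add)
  also have "\<dots> = {x + int b ^ m * y | x y.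
        x \<in> iterated_digits b D m \<and> y \<in> iterated_digits b D (Suc n)}"
    by (auto simp: iterated_digits_Suc; metis)
  finally show ?case .
qed

lemma iterated_digits_1 [simp]: "iterated_digits b D (Suc 0) = D"
  by (simp add: iterated_digits_Suc)

lemma iterated_digits_Suc_low:
  "iterated_digits b D (Suc n) = {d + int b * e | d e. d \<in> D \<and> e \<in> iterated_digits b D n}"
  using iterated_digits_add[of b D 1 n] by simp

lemma iterated_digits_mult:
  "iterated_digits (b ^ l) (iterated_digits b D l) n = iterated_digits b D (l * n)"
proof (induction n)
  case (Suc n)
  have "iterated_digits b D (l * Suc n) = iterated_digits b D (l * n + l)"
    by (simp add: add.commute)
  then show ?case
    by (simp add: iterated_digits_Suc iterated_digits_add Suc power_mult)
qed simp

lemma iterated_digits_translate: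
  "iterated_digits b ((\<lambda>d. d + c) ` D) n =
     (\<lambda>x. x + c * (\<Sum>i<n. int b ^ i)) ` iterated_digits b D n"
proof (induction n)
  case (Suc n)
  have "iterated_digits b ((\<lambda>d. d + c) ` D) (Suc n) =
      {(x + c * (\<Sum>i<n. int b ^ i)) + int b ^ n * (d + c) | x d. x \<in> iterated_digits b D n \<and> d \<in> D}"
    unfolding iterated_digits_Suc Suc by blast
  also have "\<dots> = {(x + int b ^ n * d) + c * (\<Sum>i<Suc n. int b ^ i) | x d.
      x \<in> iterated_digits b D n \<and> d \<in> D}"
    by (simp add: algebra_simps)
  also have "\<dots> = (\<lambda>x. x + c * (\<Sum>i<Suc n. int b ^ i)) ` iterated_digits b D (Suc n)"
    unfolding iterated_digits_Suc by blast
  finally show ?case .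
qed simp

lemma finite_iterated_digits: "finite D \<Longrightarrow> finite (iterated_digits b D n)"
proof (induction n)
  case (Suc n)
  have "iterated_digits b D (Suc n) =
      (\<lambda>(e, d). e + int b ^ n * d) ` (iterated_digits b D n \<times> D)"
    by (auto simp: iterated_digits_Suc)
  then show ?case using Suc by simp
qed simp

lemma card_iterated_digits_le:
  assumes "finite D" "card D \<le> b"
  shows "card (iterated_digits b D n) \<le> b ^ n"
proof (induction n)
  case (Suc n)
  have "iterated_digits b D (Suc n) =
      (\<lambda>(e, d). e + int b ^ n * d) ` (iterated_digits b D n \<times> D)"
    by (auto simp: iterated_digits_Suc)
  then have "card (iterated_digits b D (Suc n)) \<le> card (iterated_digits b D n \<times> D)"
    using assms finite_iterated_digits by (metis card_image_le finite_cartesian_product)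
  also have "\<dots> \<le> b ^ n * b"
    using Suc assms by (simp add: card_cartesian_product mult_le_mono)
  finally show ?case by (simp add: mult.commute)
qed simp

lemma zero_in_iterated_digits: "0 \<in> D \<Longrightarrow> 0 \<in> iterated_digits b D n"
proof (induction n)
  case (Suc n)
  then show ?case unfolding iterated_digits_Suc by force
qed simp

lemma iterated_digits_mono:
  assumes "0 \<in> D" "m \<le> n"
  shows "iterated_digits b D m \<subseteq> iterated_digits b D n"
proof -
  obtain k where "n = m + k" using assms(2) le_Suc_ex by blast
  then show ?thesis
    using zero_in_iterated_digits[OF assms(1)] by (force simp: iterated_digits_add)
qed

section \<open>Self-replicating sets and the attractor\<close>

text \<open>The equation \<open>N S = S + E\<close>, in the pointwise form in which it iterates by substitution
  and in which a change of origin is a change of variable.\<close>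

definition self_replicating :: "nat \<Rightarrow> int set \<Rightarrow> real set \<Rightarrow> bool"
  where "self_replicating N E S \<longleftrightarrow> (\<forall>x. x \<in> S \<longleftrightarrow> (\<exists>e\<in>E. of_nat N * x - of_int e \<in> S))"

lemma self_replicating_iff_fixed_point:
  assumes "N > 0"
  shows "self_replicating N E S \<longleftrightarrow> S = (\<Union>e\<in>E. (\<lambda>x. (x + of_int e) / of_nat N) ` S)"
proof -
  have "x \<in> (\<lambda>x. (x + of_int e) / of_nat N) ` S \<longleftrightarrow> of_nat N * x - of_int e \<in> S" for x e
  proof
    show "of_nat N * x - of_int e \<in> S" if "x \<in> (\<lambda>x. (x + of_int e) / of_nat N) ` S"
      using that assms by auto
    show "x \<in> (\<lambda>x. (x + of_int e) / of_nat N) ` S" if "of_nat N * x - of_int e \<in> S"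
      by (rule image_eqI[OF _ that]) (use assms in auto)
  qed
  then show ?thesis unfolding self_replicating_def set_eq_iff by auto
qed

lemma self_replicating_iterate:
  assumes "self_replicating N E S"
  shows "self_replicating (N ^ n) (iterated_digits N E n) S"
proof (induction n)
  case 0
  then show ?case by (simp add: self_replicating_def)
next
  case (Suc n)
  have "x \<in> S \<longleftrightarrow> (\<exists>e\<in>iterated_digits N E (Suc n). of_nat (N ^ Suc n) * x - of_int e \<in> S)" for x
  proof -
    have "x \<in> S \<longleftrightarrow> (\<exists>d\<in>E. of_nat N * x - of_int d \<in> S)"
      using assms unfolding self_replicating_def by blast
    also have "\<dots> \<longleftrightarrow> (\<exists>d\<in>E. \<exists>e\<in>iterated_digits N E n.
        of_nat (N ^ n) * (of_nat N * x - of_int d) - of_int e \<in> S)"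
      using Suc unfolding self_replicating_def by blast
    also have "\<dots> \<longleftrightarrow> (\<exists>d\<in>E. \<exists>e\<in>iterated_digits N E n.
        of_nat (N ^ Suc n) * x - of_int (e + int N ^ n * d) \<in> S)"
      by (simp add: algebra_simps)
    also have "\<dots> \<longleftrightarrow> (\<exists>e\<in>iterated_digits N E (Suc n). of_nat (N ^ Suc n) * x - of_int e \<in> S)"
      unfolding iterated_digits_Suc by blast
    finally show ?thesis .
  qed
  then show ?case unfolding self_replicating_def by blast
qed

lemma self_replicatingD:
  assumes "self_replicating N E S" "x \<in> S"
  obtains e where "e \<in> iterated_digits N E n" "of_nat N ^ n * x - of_int e \<in> S"
  using self_replicating_iterate[OF assms(1), of n] assms(2)
  unfolding self_replicating_def of_nat_power by blast

lemma self_replicatingI: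
  assumes "self_replicating N E S" "e \<in> iterated_digits N E n" "of_nat N ^ n * x - of_int e \<in> S"
  shows "x \<in> S"
  using self_replicating_iterate[OF assms(1), of n] assms(2,3)
  unfolding self_replicating_def of_nat_power by blast

text \<open>The rescaled cell \<open>N\<^sup>-\<^sup>n (S + e)\<close> of a point of \<open>S\<close> shrinks to that point, and the same
  cell of \<open>S'\<close> lies in \<open>S'\<close>; so \<open>S'\<close> comes arbitrarily close to every point of \<open>S\<close>.\<close>

lemma self_replicating_subset:
  assumes N: "N \<ge> 2" and S: "compact S" "self_replicating N E S"
    and S': "compact S'" "S' \<noteq> {}" "self_replicating N E S'"
  shows "S \<subseteq> S'"
proof
  fix x assume x: "x \<in> S"
  obtain s' where s': "s' \<in> S'" using S' by auto
  obtain M where M: "\<And>s. s \<in> S \<Longrightarrow> \<bar>s\<bar> \<le> M"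
    using compact_imp_bounded[OF S(1)] by (auto simp: bounded_iff)
  have "\<exists>p\<in>S'. \<bar>p - x\<bar> \<le> (\<bar>s'\<bar> + M) * (1 / real N) ^ n" for n
  proof -
    obtain e where e: "e \<in> iterated_digits N E n" "real N ^ n * x - of_int e \<in> S"
      using self_replicatingD[OF S(2) x] by blast
    define p where "p = (s' + of_int e) / real N ^ n"
    have Np: "real N ^ n * p - of_int e = s'" unfolding p_def using N by simp
    then have "p \<in> S'" using self_replicatingI[OF S'(3) e(1)] s' by metis
    moreover have "p - x = (s' - (real N ^ n * x - of_int e)) * (1 / real N) ^ n"
      unfolding p_def using N by (simp add: field_simps)
    then have "\<bar>p - x\<bar> = \<bar>s' - (real N ^ n * x - of_int e)\<bar> * (1 / real N) ^ n"
      by (simp add: abs_mult)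
    then have "\<bar>p - x\<bar> \<le> (\<bar>s'\<bar> + M) * (1 / real N) ^ n"
      using M[OF e(2)] by (auto intro!: mult_right_mono)
    ultimately show ?thesis by blast
  qed
  then obtain p where p: "\<And>n. p n \<in> S'" "\<And>n. \<bar>p n - x\<bar> \<le> (\<bar>s'\<bar> + M) * (1 / real N) ^ n"
    by metis
  have "(\<lambda>n. (\<bar>s'\<bar> + M) * (1 / real N) ^ n) \<longlonglongrightarrow> 0"
    using N by (intro tendsto_mult_right_zero LIMSEQ_power_zero) auto
  then have "(\<lambda>n. p n - x) \<longlonglongrightarrow> 0"
    by (rule Lim_null_comparison[rotated]) (use p(2) in auto)
  then have "p \<longlonglongrightarrow> x" by (simp add: LIM_zero_iff)
  with p(1) show "x \<in> S'"
    using compact_imp_closed[OF S'(1)] closed_sequentially by blast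
qed

text \<open>The attractor consists of the points that, at every scale \<open>b\<^sup>-\<^sup>n\<close>, lie within a fixed
  multiple of that scale of some digit expansion of length \<open>n\<close>.  Any bound \<open>C\<close> on the digits
  works as the multiple because \<open>(C + C) / b \<le> C\<close>, which also makes these conditions
  increasingly strict; a digit that is good at infinitely many scales is then good at all.\<close>

lemma ex_compact_self_replicating:
  assumes b: "b \<ge> 2" and D: "finite D" "0 \<in> D"
  shows "\<exists>T. compact T \<and> T \<noteq> {} \<and> self_replicating b D T"
proof -
  define C where "C = real_of_int (Max (abs ` D))"
  have C: "\<bar>real_of_int d\<bar> \<le> C" if "d \<in> D" for d
  proof -
    have "\<bar>d\<bar> \<le> Max (abs ` D)" using D that by (intro Max_ge) auto
    then show ?thesis unfolding C_def by linarith
  qed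
  have C0: "C \<ge> 0" using C[OF D(2)] by simp
  have contract: "\<bar>y\<bar> \<le> C" if "\<bar>real b * y\<bar> \<le> C + C" for y
  proof -
    have "2 * \<bar>y\<bar> \<le> real b * \<bar>y\<bar>" using b by (intro mult_right_mono) auto
    also have "\<dots> \<le> 2 * C" using that by (simp add: abs_mult)
    finally show ?thesis by simp
  qed
  define K where "K n = {x. \<exists>e\<in>iterated_digits b D n. \<bar>real b ^ n * x - of_int e\<bar> \<le> C}" for n
  define T where "T = (\<Inter>n. K n)"
  have K_Suc: "K (Suc n) \<subseteq> K n" for n
  proof
    fix x assume "x \<in> K (Suc n)"
    then obtain e d where e: "e \<in> iterated_digits b D n" "d \<in> D"
      "\<bar>real b ^ Suc n * x - of_int (d + int b * e)\<bar> \<le> C"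
      unfolding K_def iterated_digits_Suc_low by auto
    have "real b * (real b ^ n * x - of_int e)
        = (real b ^ Suc n * x - of_int (d + int b * e)) + of_int d"
      by (simp add: algebra_simps)
    then have "\<bar>real b * (real b ^ n * x - of_int e)\<bar> \<le> C + C"
      using e(3) C[OF e(2)] by linarith
    then show "x \<in> K n" unfolding K_def using e(1) contract by blast
  qed
  have K_anti: "K n \<subseteq> K m" if "m \<le> n" for m n
    using that by (rule lift_Suc_antimono_le[of K, OF K_Suc])
  have K_split: "x \<in> K (Suc n) \<longleftrightarrow> (\<exists>d\<in>D. real b * x - of_int d \<in> K n)" for x n
  proof -
    have eq: "real b ^ Suc n * x - of_int (e + int b ^ n * d)
        = real b ^ n * (real b * x - of_int d) - of_int e" for e d
      by (simp add: algebra_simps)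
    have "x \<in> K (Suc n) \<longleftrightarrow> (\<exists>e\<in>iterated_digits b D n. \<exists>d\<in>D.
        \<bar>real b ^ Suc n * x - of_int (e + int b ^ n * d)\<bar> \<le> C)"
      unfolding K_def iterated_digits_Suc by blast
    then show ?thesis unfolding eq unfolding K_def by blast
  qed
  have "closed (K n)" for n
  proof -
    have "K n = (\<Union>e\<in>iterated_digits b D n. {x. \<bar>real b ^ n * x - of_int e\<bar> \<le> C})"
      unfolding K_def by auto
    then show ?thesis
      using finite_iterated_digits[OF D(1)]
      by (auto intro!: closed_UN closed_Collect_le continuous_intros)
  qed
  then have "closed T" unfolding T_def by auto
  moreover have "T \<subseteq> {-C..C}" unfolding T_def K_def by (auto dest!: spec[of _ 0])
  then have "bounded T" using bounded_closed_interval bounded_subset by blast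
  ultimately have "compact T" by (simp add: compact_eq_bounded_closed)
  moreover have "0 \<in> T" unfolding T_def K_def
    using zero_in_iterated_digits[OF D(2)] C0 by force
  moreover have "self_replicating b D T"
    unfolding self_replicating_def
  proof (intro allI iffI)
    fix x assume "\<exists>d\<in>D. real b * x - of_int d \<in> T"
    then have "x \<in> K (Suc n)" for n unfolding K_split T_def by blast
    then show "x \<in> T" unfolding T_def using K_Suc by blast
  next
    fix x assume x: "x \<in> T"
    show "\<exists>d\<in>D. real b * x - of_int d \<in> T"
    proof (rule ccontr)
      assume "\<not> ?thesis"
      then have "\<forall>d\<in>D. \<exists>n. real b * x - of_int d \<notin> K n" unfolding T_def by blast
      then obtain n where n: "\<And>d. d \<in> D \<Longrightarrow> real b * x - of_int d \<notin> K (n d)"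
        by metis
      have "x \<in> K (Suc (Max (n ` D)))" using x unfolding T_def by blast
      then obtain d where d: "d \<in> D" "real b * x - of_int d \<in> K (Max (n ` D))"
        unfolding K_split by blast
      have "n d \<le> Max (n ` D)" using d D by (intro Max_ge) auto
      then show False using K_anti d n by blast
    qed
  qed
  ultimately show ?thesis by blast
qed

lemma attractor_self_replicating:
  assumes b: "b \<ge> 2" and D: "finite D" "0 \<in> D"
  shows "compact (attractor b D)" "attractor b D \<noteq> {}" "self_replicating b D (attractor b D)"
proof -
  define P where "P T \<longleftrightarrow> compact T \<and> T \<noteq> {} \<and> self_replicating b D T" for T
  obtain T where T: "P T" using ex_compact_self_replicating[OF assms] unfolding P_def by blast
  have "T' = T''" if "P T'" "P T''" for T' T''
    using self_replicating_subset[OF b] that unfolding P_def by (metis subset_antisym)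
  moreover have "attractor b D = The P"
    unfolding attractor_def P_def
    using self_replicating_iff_fixed_point[of b D] b by simp
  ultimately have "P (attractor b D)" using T by (metis theI)
  then show "compact (attractor b D)" "attractor b D \<noteq> {}"
    "self_replicating b D (attractor b D)" unfolding P_def by auto
qed

section \<open>Skew-product-form digit sets give tiles\<close>

text \<open>Integers are expanded with a carry.  The residues of \<open>A \<oplus> B\<^sub>j\<close> write \<open>z\<close> as
  \<open>\<beta> + a\<^sub>i + N z'\<close> with \<open>\<beta> \<in> B\<^sub>j\<close>, so that \<open>a\<^sub>j + N z = (a\<^sub>j + N \<beta>) + N (a\<^sub>i + N z')\<close>: one digit
  of \<open>E\<close> has been split off and what remains has the same shape, with \<open>i\<close> in place of \<open>j\<close>.  Each
  step divides \<open>z\<close> by \<open>N\<close>, up to a bounded error, so after \<open>n\<close> steps a bounded remainder is left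
  when \<open>z\<close> has size about \<open>N\<^sup>n\<close>.\<close>

lemma skew_product_form_expansion:
  assumes N: "N \<ge> 2" and skew: "skew_product_form N E"
  shows "\<exists>c K. \<forall>n z. \<bar>z\<bar> \<le> int N ^ n \<longrightarrow>
    (\<exists>e\<in>iterated_digits N E n. \<exists>f. \<bar>f\<bar> \<le> K \<and> c + int N * z = e + int N ^ n * f)"
proof -
  obtain s :: nat and a :: "nat \<Rightarrow> int" and B :: "nat \<Rightarrow> int set" where
    E: "finite E" "card E = N" "E = (\<Union>j<s. a j +o (int N *o B j))"
    and B: "\<And>j. j < s \<Longrightarrow> direct_sum (a ` {..<s}) (B j) \<and> complete_residue_set N (a ` {..<s} + B j)"
    using skew unfolding skew_product_form_def by blast
  have crs: "complete_residue_set N (a ` {..<s} + B j)" if "j < s" for j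
    using B[OF that] by blast
  have s: "s > 0" using E N by (cases s) auto
  define R where "R = (\<Union>j<s. a ` {..<s} + B j)"
  have finR: "finite R" using crs unfolding R_def complete_residue_set_def by blast
  define C where "C = Max (insert 0 (abs ` R))"
  define A where "A = Max (abs ` a ` {..<s})"
  have C: "\<bar>r\<bar> \<le> C" if "r \<in> R" for r
    unfolding C_def using finR that by (intro Max_ge) auto
  have C0: "C \<ge> 0" unfolding C_def using finR by (intro Max_ge) auto
  have A: "\<bar>a j\<bar> \<le> A" if "j < s" for j
    unfolding A_def using that by (intro Max_ge) auto
  define K where "K = A + int N * (1 + C)"
  have split: "\<exists>\<beta> i z'. \<beta> \<in> B j \<and> i < s \<and> z = \<beta> + a i + int N * z' \<and> int N * \<bar>z'\<bar> \<le> \<bar>z\<bar> + C"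
    if j: "j < s" for j z
  proof -
    let ?R = "a ` {..<s} + B j"
    have R: "finite ?R" "card ?R = N" "\<And>x y. x \<in> ?R \<Longrightarrow> y \<in> ?R \<Longrightarrow> x mod int N = y mod int N \<Longrightarrow> x = y"
      using crs[OF j] unfolding complete_residue_set_def by blast+
    have "inj_on (\<lambda>x. x mod int N) ?R" using R(3) by (auto simp: inj_on_def)
    then have "card ((\<lambda>x. x mod int N) ` ?R) = card {0..<int N}"
      by (simp add: card_image R(2))
    moreover have "(\<lambda>x. x mod int N) ` ?R \<subseteq> {0..<int N}" using N by auto
    ultimately have "(\<lambda>x. x mod int N) ` ?R = {0..<int N}"
      by (intro card_subset_eq) auto
    moreover have "z mod int N \<in> {0..<int N}" using N by auto
    ultimately obtain r where r: "r \<in> ?R" "z mod int N = r mod int N" by blast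
    then obtain \<beta> i where bi: "\<beta> \<in> B j" "i < s" "r = a i + \<beta>"
      unfolding set_plus_def by auto
    obtain z' where z': "z = r + int N * z'"
      using r(2) by (metis mod_eqE diff_add_cancel add.commute mult.commute mod_eq_dvd_iff dvdE)
    have "r \<in> R" unfolding R_def using r(1) j by blast
    have "int N * \<bar>z'\<bar> = \<bar>z - r\<bar>" using z' by (simp add: abs_mult)
    also have "\<dots> \<le> \<bar>z\<bar> + C" using C[OF \<open>r \<in> R\<close>] by linarith
    finally show ?thesis using bi z' by (metis add.commute)
  qed
  \<comment> \<open>The slack \<open>C\<close> in the bound on \<open>z\<close> is what makes it inductive: \<open>(N\<^sup>n\<^sup>+\<^sup>1 + C + C) / N \<le> N\<^sup>n + C\<close>.\<close>
  have "\<exists>e\<in>iterated_digits N E n. \<exists>f. \<bar>f\<bar> \<le> K \<and> a j + int N * z = e + int N ^ n * f"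
    if "j < s" "\<bar>z\<bar> \<le> int N ^ n + C" for n j z
    using that
  proof (induction n arbitrary: j z)
    case 0
    have "\<bar>int N * z\<bar> \<le> int N * (1 + C)" using 0 by (simp add: abs_mult mult_left_mono)
    then have "\<bar>a j + int N * z\<bar> \<le> K" unfolding K_def using A[OF 0(1)] by linarith
    then show ?case by simp
  next
    case (Suc n)
    obtain \<beta> i z' where z': "\<beta> \<in> B j" "i < s" "z = \<beta> + a i + int N * z'"
      "int N * \<bar>z'\<bar> \<le> \<bar>z\<bar> + C"
      using split[OF Suc.prems(1)] by blast
    have "2 * C \<le> int N * C" using N C0 by (intro mult_right_mono) auto
    then have "int N * \<bar>z'\<bar> \<le> int N * (int N ^ n + C)"
      using z'(4) Suc.prems(2) by (simp add: algebra_simps)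
    then have "\<bar>z'\<bar> \<le> int N ^ n + C" using N by simp
    from Suc.IH[OF z'(2) this] obtain e f where
      e: "e \<in> iterated_digits N E n" "\<bar>f\<bar> \<le> K" "a i + int N * z' = e + int N ^ n * f"
      by blast
    have "a j + int N * \<beta> \<in> E"
      unfolding E(3) elt_set_plus_def elt_set_times_def using z'(1) Suc.prems(1) by blast
    then have "(a j + int N * \<beta>) + int N * e \<in> iterated_digits N E (Suc n)"
      unfolding iterated_digits_Suc_low using e(1) by blast
    moreover have "a j + int N * z = ((a j + int N * \<beta>) + int N * e) + int N ^ Suc n * f"
    proof -
      have "a j + int N * z = a j + int N * \<beta> + int N * (a i + int N * z')"
        unfolding z'(3) by (simp add: algebra_simps)
      then show ?thesis unfolding e(3) by (simp add: algebra_simps)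
    qed
    ultimately show ?case using e(2) by blast
  qed
  then have "\<forall>n z. \<bar>z\<bar> \<le> int N ^ n \<longrightarrow>
      (\<exists>e\<in>iterated_digits N E n. \<exists>f. \<bar>f\<bar> \<le> K \<and> a 0 + int N * z = e + int N ^ n * f)"
    using s C0 by (meson add_increasing2 order_trans order_refl)
  then show ?thesis by blast
qed

text \<open>Dividing the expansions above by \<open>N\<^sup>n\<close> shows that finitely many integer translates of \<open>S\<close>
  come arbitrarily close to every point of \<open>[0, 1]\<close>, hence cover it; a finite union of closed
  sets without interior has no interior.\<close>

lemma skew_product_form_interior:
  assumes N: "N \<ge> 2" and skew: "skew_product_form N E"
    and S: "compact S" "S \<noteq> {}" "self_replicating N E S"
  shows "interior S \<noteq> {}"
proof
  assume int: "interior S = {}"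
  obtain c K where cK: "\<And>n z. \<bar>z\<bar> \<le> int N ^ n \<Longrightarrow>
    \<exists>e\<in>iterated_digits N E n. \<exists>f. \<bar>f\<bar> \<le> K \<and> c + int N * z = e + int N ^ n * f"
    using skew_product_form_expansion[OF N skew] by blast
  obtain s where s: "s \<in> S" using S by auto
  define U where "U = (\<Union>f\<in>{-K..K}. (+) (real_of_int f) ` S)"
  have clo: "closed ((+) (real_of_int f) ` S)" for f
    using S(1) compact_imp_closed closed_translation by blast
  have "{0..1} \<subseteq> U"
  proof
    fix x :: real assume x: "x \<in> {0..1}"
    define z where "z n = \<lfloor>x * real N ^ n\<rfloor>" for n
    define p where "p n = (of_int c + real N * of_int (z n) + s) / real N ^ Suc n" for n
    have zN: "\<bar>z n\<bar> \<le> int N ^ Suc n" for n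
    proof -
      have "x * real N ^ n \<le> 1 * real N ^ n" using x by (intro mult_right_mono) auto
      also have "\<dots> \<le> real N ^ Suc n" using N by simp
      finally have "real_of_int (z n) \<le> of_int (int N ^ Suc n)" unfolding z_def
        by (simp add: order_trans[OF of_int_floor_le])
      then have "z n \<le> int N ^ Suc n" using of_int_le_iff by blast
      moreover have "z n \<ge> 0" unfolding z_def using x by auto
      ultimately show ?thesis by simp
    qed
    have "p n \<in> U" for n
    proof -
      obtain e f where e: "e \<in> iterated_digits N E (Suc n)" "\<bar>f\<bar> \<le> K"
        "c + int N * z n = e + int N ^ Suc n * f"
        using cK[OF zN] by blast
      have eq: "of_int c + real N * of_int (z n) = of_int e + real N ^ Suc n * of_int f"
        using arg_cong[OF e(3), of real_of_int] by simp
      have "real N ^ Suc n * (p n - of_int f) - of_int e = s"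
        unfolding p_def eq using N by (simp add: field_simps)
      then have "p n - of_int f \<in> S" using self_replicatingI[OF S(3) e(1)] s by metis
      then have "p n \<in> (+) (real_of_int f) ` S" by (metis add.commute diff_add_cancel imageI)
      then show ?thesis unfolding U_def using e(2) by (auto simp: abs_le_iff)
    qed
    moreover have "p \<longlonglongrightarrow> x"
    proof -
      have bound: "norm (p n - x) \<le> (\<bar>of_int c + s\<bar> + real N) * (1 / real N) ^ n" for n
      proof -
        have "p n - x = (of_int c + s + real N * (of_int (z n) - x * real N ^ n)) / real N ^ Suc n"
          unfolding p_def using N by (simp add: field_simps)
        then have "\<bar>p n - x\<bar>
            = \<bar>of_int c + s + real N * (of_int (z n) - x * real N ^ n)\<bar> / real N ^ Suc n"
          by simp
        also have "\<dots> \<le> (\<bar>of_int c + s\<bar> + real N) / real N ^ Suc n"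
        proof (rule divide_right_mono)
          have "\<bar>of_int (z n) - x * real N ^ n\<bar> \<le> 1" unfolding z_def by linarith
          then have "\<bar>real N * (of_int (z n) - x * real N ^ n)\<bar> \<le> real N"
            by (simp add: abs_mult mult_left_le)
          then show "\<bar>of_int c + s + real N * (of_int (z n) - x * real N ^ n)\<bar>
            \<le> \<bar>of_int c + s\<bar> + real N" by linarith
        qed simp
        also have "\<dots> \<le> (\<bar>of_int c + s\<bar> + real N) / real N ^ n"
          using N by (intro divide_left_mono) auto
        finally show ?thesis by (simp add: power_one_over)
      qed
      have "(\<lambda>n. (\<bar>of_int c + s\<bar> + real N) * (1 / real N) ^ n) \<longlonglongrightarrow> 0"
        using N by (intro tendsto_mult_right_zero LIMSEQ_power_zero) auto
      then have "(\<lambda>n. p n - x) \<longlonglongrightarrow> 0"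
        by (rule Lim_null_comparison[rotated]) (use bound in auto)
      then show ?thesis by (simp add: LIM_zero_iff)
    qed
    moreover have "closed U" unfolding U_def using clo by auto
    ultimately show "x \<in> U" using closed_sequentially by blast
  qed
  moreover have "interior (\<Union>f\<in>F. (+) (real_of_int f) ` S) = {}" if "finite F" for F
    using that
  proof induction
    case (insert f F)
    then show ?case
      using interior_closed_Un_empty_interior[OF clo[of f]] by (simp add: interior_translation int)
  qed simp
  then have "interior U = {}" unfolding U_def by simp
  ultimately have "interior {0..1::real} = {}" using interior_mono by blast
  then show False by (simp add: interior_atLeastAtMost_real)
qed

section \<open>Tiles with an interior origin\<close>

text \<open>For a tile \<open>S\<close> with \<open>N S = S + E\<close> that has \<open>0\<close> in its interior, the translates of \<open>S\<close> by
  the integers with finite digit expansions tile the line: \<open>N\<^sup>n S\<close> is tiled by the translates by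
  digit expansions of length \<open>n\<close>, and \<open>N\<^sup>n S\<close> exhausts the line.\<close>

locale centered_tile =
  fixes N :: nat and E :: "int set" and S :: "real set"
  assumes N: "N \<ge> 2" and finite_E: "finite E" and card_E: "card E \<le> N" and zero_E: "0 \<in> E"
    and compact_S: "compact S" and zero_S: "0 \<in> interior S"
    and replicating: "self_replicating N E S"
begin

abbreviation digits :: "nat \<Rightarrow> int set" where "digits \<equiv> iterated_digits N E"

definition shift :: "int \<Rightarrow> real set" where "shift z = (+) (real_of_int z) ` S"

definition overlap :: "int \<Rightarrow> int \<Rightarrow> bool"
  where "overlap z w \<longleftrightarrow> \<not> negligible (shift z \<inter> shift w)"

definition packing :: "int set \<Rightarrow> bool"
  where "packing J \<longleftrightarrow> (\<forall>z\<in>J. \<forall>w\<in>J. z \<noteq> w \<longrightarrow> \<not> overlap z w)"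

definition covering :: "int set \<Rightarrow> bool"
  where "covering J \<longleftrightarrow> (\<forall>x. \<exists>z\<in>J. x - of_int z \<in> S)"

definition J :: "int set" where "J = (\<Union>n. digits n)"

lemma mem_shift: "x \<in> shift z \<longleftrightarrow> x - of_int z \<in> S"
  unfolding shift_def by (metis add.commute diff_add_cancel image_iff add_diff_cancel_left')

lemma overlap_translate: "overlap (z + c) (w + c) \<longleftrightarrow> overlap z w"
proof -
  have "shift (z + c) \<inter> shift (w + c) = (+) (real_of_int c) ` (shift z \<inter> shift w)"
    unfolding shift_def by (auto simp: image_iff algebra_simps; metis)
  then show ?thesis unfolding overlap_def
    using negligible_translation negligible_translation_rev by metis
qed

lemma packingD: "packing A \<Longrightarrow> z \<in> A \<Longrightarrow> w \<in> A \<Longrightarrow> overlap z w \<Longrightarrow> z = w"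
  unfolding packing_def by blast

lemma finite_digits: "finite (digits n)"
  using finite_iterated_digits finite_E by blast

lemma measure_S_pos: "measure lebesgue S > 0"
proof -
  have "\<not> negligible (interior S)" using open_not_negligible zero_S by blast
  then have "\<not> negligible S" using interior_subset negligible_subset by blast
  moreover have "S \<in> lmeasurable" using compact_S lmeasurable_compact by blast
  ultimately show ?thesis using negligible_iff_measure by (metis measure_nonneg order_less_le)
qed

lemma compact_shift: "compact (shift z)"
  unfolding shift_def using compact_S compact_translation by blast

lemma lmeasurable_shift: "shift z \<in> lmeasurable"
  using compact_shift lmeasurable_compact by blast

lemma measure_shift: "measure lebesgue (shift z) = measure lebesgue S"
  unfolding shift_def by (rule measure_translation)

lemma measure_Union_digits:
  "measure lebesgue (\<Union>e\<in>digits n. shift e) = real N ^ n * measure lebesgue S"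
proof -
  have "(\<Union>e\<in>digits n. shift e) = (\<lambda>x. real N ^ n *\<^sub>R x + 0) ` S"
  proof (intro set_eqI iffI)
    fix x assume "x \<in> (\<Union>e\<in>digits n. shift e)"
    then obtain e where e: "e \<in> digits n" "x - of_int e \<in> S" by (auto simp: mem_shift)
    have x: "x = real N ^ n * (x / real N ^ n)" using N by simp
    then have "x / real N ^ n \<in> S" using self_replicatingI[OF replicating e(1)] e(2) by metis
    then show "x \<in> (\<lambda>x. real N ^ n *\<^sub>R x + 0) ` S" using x by force
  next
    fix x assume "x \<in> (\<lambda>x. real N ^ n *\<^sub>R x + 0) ` S"
    then obtain y where y: "y \<in> S" "x = real N ^ n * y" by auto
    then show "x \<in> (\<Union>e\<in>digits n. shift e)"
      using self_replicatingD[OF replicating y(1), of n] by (metis UN_iff mem_shift)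
  qed
  then show ?thesis using measure_lebesgue_affine[of "real N ^ n" 0 S] by simp
qed

text \<open>At least \<open>N\<^sup>n\<close> translates of \<open>S\<close> are needed to make up the measure of \<open>N\<^sup>n S\<close>, and there
  are at most that many digit sums.  With equality, no measure can be lost to overlaps.\<close>

lemma card_digits: "card (digits n) = N ^ n"
proof -
  have "real N ^ n * measure lebesgue S \<le> (\<Sum>e\<in>digits n. measure lebesgue (shift e))"
    unfolding measure_Union_digits[symmetric]
    using finite_digits lmeasurable_shift by (intro measure_UNION_le) auto
  also have "\<dots> = real (card (digits n)) * measure lebesgue S" by (simp add: measure_shift)
  finally have "real N ^ n \<le> real (card (digits n))" using measure_S_pos by simp
  then have "N ^ n \<le> card (digits n)" by (metis of_nat_le_iff of_nat_power)
  then show ?thesis using card_iterated_digits_le[OF finite_E card_E] by (simp add: order_antisym)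
qed

lemma packing_digits: "packing (digits n)"
  unfolding packing_def
proof (intro ballI impI)
  fix z w assume z: "z \<in> digits n" and w: "w \<in> digits n" and ne: "z \<noteq> w"
  let ?m = "measure lebesgue"
  define R where "R = (\<Union>e\<in>digits n - {z}. shift e)"
  have Rm: "R \<in> lmeasurable"
    unfolding R_def using finite_digits lmeasurable_shift by (intro fmeasurable.finite_UN) auto
  have zw: "shift z \<inter> shift w \<in> lmeasurable" using lmeasurable_shift by blast
  have "(\<Union>e\<in>digits n. shift e) = R \<union> (shift z - shift z \<inter> shift w)"
    unfolding R_def using z w ne by auto
  then have "real N ^ n * ?m S = ?m (R \<union> (shift z - shift z \<inter> shift w))"
    using measure_Union_digits by metis
  also have "\<dots> \<le> ?m R + ?m (shift z - shift z \<inter> shift w)"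
    using Rm zw lmeasurable_shift by (intro measure_Un_le) auto
  also have "?m (shift z - shift z \<inter> shift w) = ?m S - ?m (shift z \<inter> shift w)"
    using zw lmeasurable_shift by (subst measurable_measure_Diff) (auto simp: measure_shift)
  also have "?m R \<le> (\<Sum>e\<in>digits n - {z}. ?m (shift e))"
    unfolding R_def using finite_digits lmeasurable_shift by (intro measure_UNION_le) auto
  also have "\<dots> = (real N ^ n - 1) * ?m S"
    using z finite_digits N by (simp add: measure_shift card_Diff_singleton card_digits of_nat_diff)
  finally have "?m (shift z \<inter> shift w) \<le> 0" by (simp add: algebra_simps)
  then show "\<not> overlap z w"
    unfolding overlap_def using zw by (simp add: negligible_iff_measure measure_le_0_iff)
qed

lemma digits_subset_J: "digits n \<subseteq> J"
  unfolding J_def by blast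

lemma J_common_digits:
  assumes "x \<in> J" "y \<in> J"
  obtains n where "x \<in> digits n" "y \<in> digits n"
proof -
  obtain k l where "x \<in> digits k" "y \<in> digits l" using assms unfolding J_def by blast
  then have "x \<in> digits (max k l)" "y \<in> digits (max k l)"
    using iterated_digits_mono[OF zero_E] by (meson max.cobounded1 max.cobounded2 subsetD)+
  then show ?thesis using that by blast
qed

lemma packing_J: "packing J"
  unfolding packing_def using packing_digits packingD by (metis J_common_digits)

lemma digits_J_closed:
  assumes "e \<in> digits n" "x \<in> J"
  shows "e + int N ^ n * x \<in> J"
proof -
  obtain k where "x \<in> digits k" using assms unfolding J_def by blast
  then have "e + int N ^ n * x \<in> digits (n + k)" using assms iterated_digits_add by blast
  then show ?thesis unfolding J_def by blast
qed

lemma J_decompose: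
  assumes "y \<in> J"
  obtains e x where "e \<in> digits n" "x \<in> J" "y = e + int N ^ n * x"
proof -
  obtain k where "y \<in> digits k" using assms unfolding J_def by blast
  then have "y \<in> digits (n + k)" using iterated_digits_mono[OF zero_E] by (meson le_add2 subsetD)
  then show ?thesis using that digits_subset_J unfolding iterated_digits_add by blast
qed

text \<open>Uniqueness of digit expansions: the \<open>N\<^sup>n N\<^sup>k\<close> sums of \<open>digits n + N\<^sup>n digits k\<close> must be
  distinct in order to exhaust \<open>digits (n + k)\<close>.\<close>

lemma J_decompose_unique:
  assumes "e \<in> digits n" "e' \<in> digits n" "x \<in> J" "x' \<in> J"
    and "e + int N ^ n * x = e' + int N ^ n * x'"
  shows "e = e' \<and> x = x'"
proof -
  obtain k where k: "x \<in> digits k" "x' \<in> digits k" using J_common_digits assms by blast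
  let ?f = "\<lambda>(e, x). e + int N ^ n * x"
  have "?f ` (digits n \<times> digits k) = digits (n + k)"
    by (auto simp: iterated_digits_add)
  then have "card (?f ` (digits n \<times> digits k)) = card (digits n \<times> digits k)"
    by (simp add: card_digits card_cartesian_product power_add)
  then have "inj_on ?f (digits n \<times> digits k)"
    using finite_digits by (intro eq_card_imp_inj_on) auto
  then show ?thesis using assms k unfolding inj_on_def by fastforce
qed

lemma large_scale_cover: "\<exists>n\<ge>1. \<forall>x. \<bar>x\<bar> \<le> M \<longrightarrow> (\<exists>e\<in>digits n. x - of_int e \<in> S)"
proof -
  obtain \<delta> where d: "\<delta> > 0" "ball 0 \<delta> \<subseteq> S" using zero_S mem_interior by blast
  obtain n where n: "\<bar>M\<bar> / \<delta> < real N ^ n" using real_arch_pow[of "real N"] N by fastforce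
  have "\<exists>e\<in>digits (Suc n). x - of_int e \<in> S" if "\<bar>x\<bar> \<le> M" for x
  proof -
    have "\<bar>x\<bar> < \<delta> * real N ^ n" using that n d(1) by (simp add: field_simps)
    also have "\<dots> \<le> \<delta> * real N ^ Suc n" using N d(1) by simp
    finally have "x / real N ^ Suc n \<in> ball 0 \<delta>" using N by (simp add: field_simps)
    then have "x / real N ^ Suc n \<in> S" using d by blast
    from self_replicatingD[OF replicating this, of "Suc n"] show ?thesis
      using N by (metis nonzero_mult_div_cancel_left times_divide_eq_right of_nat_eq_0_iff
          power_not_zero not_numeral_le_zero)
  qed
  then show ?thesis by (intro exI[of _ "Suc n"]) auto
qed

lemma covering_J: "covering J"
  unfolding covering_def using large_scale_cover digits_subset_J by (meson order_refl subsetD)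

text \<open>Points of \<open>S\<close> are limits of small rescaled copies of \<open>S\<close>, each of which contains a
  rescaled copy of a neighbourhood of \<open>0\<close>.\<close>

lemma S_subset_closure_interior: "S \<subseteq> closure (interior S)"
proof
  fix x assume x: "x \<in> S"
  obtain M where M: "\<And>s. s \<in> S \<Longrightarrow> \<bar>s\<bar> \<le> M"
    using compact_imp_bounded[OF compact_S] by (auto simp: bounded_iff)
  show "x \<in> closure (interior S)"
    unfolding closure_approachable
  proof (intro allI impI)
    fix r :: real assume r: "r > 0"
    obtain n where n: "M / r < real N ^ n" using real_arch_pow[of "real N"] N by fastforce
    obtain e where e: "e \<in> digits n" "real N ^ n * x - of_int e \<in> S"
      using self_replicatingD[OF replicating x] by blast
    define y where "y = of_int e / real N ^ n"
    define U where "U = (\<lambda>u. real N ^ n * u - of_int e) -` interior S"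
    have "open U" unfolding U_def by (intro open_vimage continuous_intros) auto
    moreover have "U \<subseteq> S" unfolding U_def
      using self_replicatingI[OF replicating e(1)] interior_subset by blast
    moreover have "y \<in> U" unfolding U_def y_def using zero_S N by simp
    ultimately have "y \<in> interior S" by (meson interiorI)
    moreover have "\<bar>y - x\<bar> = \<bar>real N ^ n * x - of_int e\<bar> / real N ^ n"
    proof -
      have "x - y = (real N ^ n * x - of_int e) / real N ^ n"
        unfolding y_def using N by (simp add: field_simps)
      then have "\<bar>x - y\<bar> = \<bar>real N ^ n * x - of_int e\<bar> / real N ^ n" by simp
      then show ?thesis by (simp add: abs_minus_commute)
    qed
    then have "\<bar>y - x\<bar> \<le> M / real N ^ n" using M[OF e(2)] by (simp add: divide_right_mono)
    moreover have "M / real N ^ n < r" using n r N by (simp add: field_simps)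
    ultimately have "y \<in> interior S" "dist y x < r" by (auto simp: dist_real_def)
    then show "\<exists>y\<in>interior S. dist y x < r" by blast
  qed
qed

text \<open>If translates \<open>S + w\<close> cover the part \<open>U + z\<close> of \<open>S + z\<close>, then finitely many of them do, and
  not all of these can meet the open set \<open>U + z\<close> in a null set.\<close>

lemma ex_overlap:
  assumes U: "open U" "U \<noteq> {}" "U \<subseteq> S"
    and cov: "\<And>u. u \<in> U \<Longrightarrow> \<exists>w\<in>A. u + of_int z - of_int w \<in> S"
  shows "\<exists>w\<in>A. overlap z w \<and> (\<exists>u\<in>U. u + of_int z - of_int w \<in> S)"
proof (rule ccontr)
  assume neg: "\<not> ?thesis"
  obtain M where M: "\<And>s. s \<in> S \<Longrightarrow> \<bar>s\<bar> \<le> M"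
    using compact_imp_bounded[OF compact_S] by (auto simp: bounded_iff)
  define W where "W = {w\<in>A. \<exists>u\<in>U. u + of_int z - of_int w \<in> S}"
  have "W \<subseteq> {z - \<lceil>2 * M\<rceil> .. z + \<lceil>2 * M\<rceil>}"
  proof
    fix w assume "w \<in> W"
    then obtain u where "u \<in> S" "u + of_int z - of_int w \<in> S" unfolding W_def using U by blast
    then have "\<bar>real_of_int z - of_int w\<bar> \<le> 2 * M"
      using M[of u] M[of "u + of_int z - of_int w"] by linarith
    then show "w \<in> {z - \<lceil>2 * M\<rceil> .. z + \<lceil>2 * M\<rceil>}" by (simp add: abs_le_iff) linarith
  qed
  then have "finite W" by (rule finite_subset) simp
  moreover have "negligible (shift z \<inter> shift w)" if "w \<in> W" for w
    using neg that unfolding W_def overlap_def by blast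
  ultimately have "negligible (\<Union>w\<in>W. shift z \<inter> shift w)" by blast
  moreover have "(+) (real_of_int z) ` U \<subseteq> (\<Union>w\<in>W. shift z \<inter> shift w)"
  proof
    fix x assume "x \<in> (+) (real_of_int z) ` U"
    then obtain u where u: "u \<in> U" "x = u + of_int z" by auto
    then obtain w where w: "w \<in> A" "u + of_int z - of_int w \<in> S" using cov by blast
    then have "w \<in> W" unfolding W_def using u by blast
    moreover have "x \<in> shift z \<inter> shift w" using u w U by (auto simp: mem_shift)
    ultimately show "x \<in> (\<Union>w\<in>W. shift z \<inter> shift w)" by blast
  qed
  ultimately have "negligible ((+) (real_of_int z) ` U)" using negligible_subset by blast
  then show False using negligible_translation_rev open_not_negligible U by blast
qed

text \<open>The part of \<open>S + z\<close> within distance \<open>1\<close> of its left end has positive measure, and an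
  integer translate of \<open>S\<close> that meets it cannot start to the right of \<open>S + z\<close>.  Likewise for the
  right end.\<close>

lemma covering_neighbours:
  obtains L :: int where "L \<ge> 0"
    "\<And>A z. covering A \<Longrightarrow> \<exists>w\<in>A. overlap z w \<and> w \<le> z \<and> z - w \<le> L"
    "\<And>A z. covering A \<Longrightarrow> \<exists>w\<in>A. overlap z w \<and> z \<le> w \<and> w - z \<le> L"
proof -
  obtain M where M: "\<And>s. s \<in> S \<Longrightarrow> \<bar>s\<bar> \<le> M"
    using compact_imp_bounded[OF compact_S] by (auto simp: bounded_iff)
  have M0: "M \<ge> 0" using M zero_S interior_subset by fastforce
  define L where "L = \<lceil>2 * M\<rceil>"
  have near: "\<bar>z - w\<bar> \<le> L" if "u \<in> S" "u + of_int z - of_int w \<in> S" for u z w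
  proof -
    have "\<bar>real_of_int z - of_int w\<bar> \<le> 2 * M"
      using M[OF that(1)] M[OF that(2)] by linarith
    then show ?thesis unfolding L_def by linarith
  qed
  have cov: "\<exists>w\<in>A. overlap z w \<and> (\<exists>u\<in>U. u + of_int z - of_int w \<in> S)"
    if "covering A" "open U" "U \<noteq> {}" "U \<subseteq> S" for A z U
    using ex_overlap that unfolding covering_def by blast
  have ne: "S \<noteq> {}" using zero_S interior_subset by blast
  show ?thesis
  proof (rule that)
    show "L \<ge> 0" unfolding L_def using M0 by simp
  next
    fix A z assume A: "covering A"
    obtain \<alpha> where \<alpha>: "\<alpha> \<in> S" "\<And>s. s \<in> S \<Longrightarrow> \<alpha> \<le> s"
      using compact_attains_inf[OF compact_S ne] by blast
    define U where "U = interior S \<inter> {..<\<alpha> + 1}"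
    obtain y where "y \<in> interior S" "dist y \<alpha> < 1"
      using \<alpha>(1) S_subset_closure_interior closure_approachable by (metis subsetD zero_less_one)
    then have "U \<noteq> {}" unfolding U_def dist_real_def by auto
    moreover have "open U" "U \<subseteq> S" unfolding U_def using interior_subset by auto
    ultimately obtain w u where w: "w \<in> A" "overlap z w" "u \<in> U" "u + of_int z - of_int w \<in> S"
      using cov A by blast
    have "real_of_int w < of_int z + 1" using \<alpha>(2)[OF w(4)] w(3) unfolding U_def by auto
    then have "w \<le> z" by linarith
    moreover have "u \<in> S" using w(3) \<open>U \<subseteq> S\<close> by blast
    then have "z - w \<le> L" using near w(4) by (auto simp: abs_le_iff)
    ultimately show "\<exists>w\<in>A. overlap z w \<and> w \<le> z \<and> z - w \<le> L" using w by blast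
  next
    fix A z assume A: "covering A"
    obtain \<beta> where \<beta>: "\<beta> \<in> S" "\<And>s. s \<in> S \<Longrightarrow> s \<le> \<beta>"
      using compact_attains_sup[OF compact_S ne] by blast
    define U where "U = interior S \<inter> {\<beta> - 1<..}"
    obtain y where "y \<in> interior S" "dist y \<beta> < 1"
      using \<beta>(1) S_subset_closure_interior closure_approachable by (metis subsetD zero_less_one)
    then have "U \<noteq> {}" unfolding U_def dist_real_def by auto
    moreover have "open U" "U \<subseteq> S" unfolding U_def using interior_subset by auto
    ultimately obtain w u where w: "w \<in> A" "overlap z w" "u \<in> U" "u + of_int z - of_int w \<in> S"
      using cov A by blast
    have "real_of_int z < of_int w + 1" using \<beta>(2)[OF w(4)] w(3) unfolding U_def by auto
    then have "z \<le> w" by linarith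
    moreover have "u \<in> S" using w(3) \<open>U \<subseteq> S\<close> by blast
    then have "w - z \<le> L" using near[of u z w] w(4) by (auto simp: abs_le_iff)
    ultimately show "\<exists>w\<in>A. overlap z w \<and> z \<le> w \<and> w - z \<le> L" using w by blast
  qed
qed

text \<open>Rigidity: outside a large window each position of a tiling is decided by the positions
  closer to the origin, because a tile that is left out must be overlapped by a tile on its inner
  side, and that overlap forbids the tile in every tiling with the same inner part.\<close>

lemma tiling_determined_by_window:
  obtains L :: int where "\<And>A A'. \<lbrakk>packing A; covering A; packing A'; covering A';
    \<And>z. \<bar>z\<bar> \<le> L \<Longrightarrow> z \<in> A \<longleftrightarrow> z \<in> A'\<rbrakk> \<Longrightarrow> A = A'"
proof -
  obtain L :: int where L: "L \<ge> 0"
    and left: "\<And>A z. covering A \<Longrightarrow> \<exists>w\<in>A. overlap z w \<and> w \<le> z \<and> z - w \<le> L"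
    and right: "\<And>A z. covering A \<Longrightarrow> \<exists>w\<in>A. overlap z w \<and> z \<le> w \<and> w - z \<le> L"
    using covering_neighbours by metis
  have step: "z \<in> A'" if "packing A" "covering A'" "z \<in> A" "\<bar>z\<bar> > L"
    and inner: "\<And>w. \<bar>w\<bar> < \<bar>z\<bar> \<Longrightarrow> w \<in> A' \<Longrightarrow> w \<in> A" for A A' z
  proof (rule ccontr)
    assume z: "z \<notin> A'"
    have "\<exists>w\<in>A'. overlap z w \<and> \<bar>w\<bar> < \<bar>z\<bar>"
    proof (cases "z > 0")
      case True
      obtain w where w: "w \<in> A'" "overlap z w" "w \<le> z" "z - w \<le> L"
        using left[OF \<open>covering A'\<close>] by blast
      then have "\<bar>w\<bar> < \<bar>z\<bar>" using z True \<open>\<bar>z\<bar> > L\<close> by (cases "w = z") auto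
      then show ?thesis using w by blast
    next
      case False
      obtain w where w: "w \<in> A'" "overlap z w" "z \<le> w" "w - z \<le> L"
        using right[OF \<open>covering A'\<close>] by blast
      then have "\<bar>w\<bar> < \<bar>z\<bar>" using z False \<open>\<bar>z\<bar> > L\<close> by (cases "w = z") auto
      then show ?thesis using w by blast
    qed
    then obtain w where "w \<in> A'" "overlap z w" "\<bar>w\<bar> < \<bar>z\<bar>" by blast
    then show False using inner packingD[OF \<open>packing A\<close> \<open>z \<in> A\<close>] z by blast
  qed
  show ?thesis
  proof (rule that)
    fix A A' assume A: "packing A" "covering A" "packing A'" "covering A'"
      and window: "\<And>z. \<bar>z\<bar> \<le> L \<Longrightarrow> z \<in> A \<longleftrightarrow> z \<in> A'"
    have "z \<in> A \<longleftrightarrow> z \<in> A'" for z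
    proof (induction "nat \<bar>z\<bar>" arbitrary: z rule: less_induct)
      case less
      then have "w \<in> A \<longleftrightarrow> w \<in> A'" if "\<bar>w\<bar> < \<bar>z\<bar>" for w using that by simp
      then show ?case using window step[of A A' z] step[of A' A z] A by (meson not_le)
    qed
    then show "A = A'" by blast
  qed
qed

text \<open>The key point.  For large \<open>n\<close> the tile \<open>N\<^sup>n S\<close>, which is tiled by \<open>digits n\<close>, covers a
  large neighbourhood of \<open>0\<close>.  For every \<open>j \<in> J\<close> its translate by \<open>N\<^sup>n j\<close> is tiled by a part of
  \<open>J\<close>, so \<open>J\<close> looks around \<open>N\<^sup>n j\<close> exactly as \<open>digits n\<close> does around \<open>0\<close>.  By rigidity \<open>N\<^sup>n j\<close> is
  a period of \<open>J\<close>.\<close>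

lemma J_periods:
  obtains n where "n \<ge> 1" "\<And>j x. j \<in> J \<Longrightarrow> x + int N ^ n * j \<in> J \<longleftrightarrow> x \<in> J"
proof -
  obtain L :: int where L: "\<And>A A'. \<lbrakk>packing A; covering A; packing A'; covering A';
      \<And>z. \<bar>z\<bar> \<le> L \<Longrightarrow> z \<in> A \<longleftrightarrow> z \<in> A'\<rbrakk> \<Longrightarrow> A = A'"
    using tiling_determined_by_window by metis
  obtain M where M: "\<And>s. s \<in> S \<Longrightarrow> \<bar>s\<bar> \<le> M"
    using compact_imp_bounded[OF compact_S] by (auto simp: bounded_iff)
  obtain n where n: "n \<ge> 1"
    "\<And>x. \<bar>x\<bar> \<le> of_int L + M \<Longrightarrow> \<exists>e\<in>digits n. x - of_int e \<in> S"
    using large_scale_cover by blast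
  define J' where "J' j = {x. x + int N ^ n * j \<in> J}" for j
  have window: "x \<in> J' j \<longleftrightarrow> x \<in> digits n" if j: "j \<in> J" and x: "\<bar>x\<bar> \<le> L" for j x
  proof
    assume "x \<in> digits n"
    then show "x \<in> J' j" unfolding J'_def using digits_J_closed j by blast
  next
    assume xJ: "x \<in> J' j"
    have "\<exists>e\<in>digits n. overlap x e \<and> (\<exists>u\<in>interior S. u + of_int x - of_int e \<in> S)"
    proof (rule ex_overlap)
      fix u assume "u \<in> interior S"
      then have "\<bar>u\<bar> \<le> M" using M interior_subset by blast
      moreover have "\<bar>real_of_int x\<bar> \<le> of_int L" using x by linarith
      ultimately have "\<bar>u + of_int x\<bar> \<le> of_int L + M" by linarith
      then show "\<exists>e\<in>digits n. u + of_int x - of_int e \<in> S" using n(2) by blast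
    qed (use zero_S interior_subset in auto)
    then obtain e where e: "e \<in> digits n" "overlap x e" by blast
    then have "e + int N ^ n * j \<in> J" using digits_J_closed j by blast
    moreover have "x + int N ^ n * j \<in> J" using xJ unfolding J'_def by simp
    ultimately have "x = e" using packingD[OF packing_J] e(2) overlap_translate by (metis add_right_cancel)
    then show "x \<in> digits n" using e by blast
  qed
  have packJ': "packing (J' j)" for j
    unfolding packing_def
  proof (intro ballI impI)
    fix z w assume "z \<in> J' j" "w \<in> J' j" "z \<noteq> w"
    then show "\<not> overlap z w"
      using packingD[OF packing_J, of "z + int N ^ n * j" "w + int N ^ n * j"] overlap_translate
      unfolding J'_def by auto
  qed
  have covJ': "covering (J' j)" for j
    unfolding covering_def
  proof
    fix x :: real
    obtain z where "z \<in> J" "x + of_int (int N ^ n * j) - of_int z \<in> S"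
      using covering_J unfolding covering_def by blast
    then have "z - int N ^ n * j \<in> J' j" "x - of_int (z - int N ^ n * j) \<in> S"
      unfolding J'_def by (simp_all add: algebra_simps)
    then show "\<exists>z\<in>J' j. x - of_int z \<in> S" by blast
  qed
  have zero: "0 \<in> J" using digits_subset_J[of 0] by simp
  have "J' j = J' 0" if "j \<in> J" for j
    using that zero by (intro L packJ' covJ') (simp add: window)
  then have "x + int N ^ n * j \<in> J \<longleftrightarrow> x \<in> J" if "j \<in> J" for j x
    using that unfolding J'_def set_eq_iff by simp
  with n(1) show ?thesis by (rule that)
qed

text \<open>The periods of \<open>J\<close> form a group, and those just found generate \<open>N\<^sup>n \<int>\<close>.\<close>

lemma J_periodic:
  assumes gcd: "Gcd E = 1"
  obtains n where "n \<ge> 1" "\<And>x w. x + int N ^ n * w \<in> J \<longleftrightarrow> x \<in> J"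
proof -
  obtain n where n: "n \<ge> 1" and per: "\<And>j x. j \<in> J \<Longrightarrow> x + int N ^ n * j \<in> J \<longleftrightarrow> x \<in> J"
    using J_periods by metis
  define P where "P = {p. \<forall>x. x + p \<in> J \<longleftrightarrow> x \<in> J}"
  have P0: "0 \<in> P" unfolding P_def by simp
  have P_add: "p + q \<in> P" if "p \<in> P" "q \<in> P" for p q
    using that unfolding P_def by (simp add: add.assoc[symmetric])
  have P_minus: "- p \<in> P" if "p \<in> P" for p
  proof -
    have "(x - p) + p \<in> J \<longleftrightarrow> x - p \<in> J" for x using that unfolding P_def by blast
    then show ?thesis unfolding P_def by simp
  qed
  have P_mult: "p * w \<in> P" if p: "p \<in> P" for p w :: int
  proof -
    have nat: "p * int k \<in> P" for k
      by (induction k) (auto simp: P0 P_add p algebra_simps)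
    show ?thesis
      by (cases w rule: int_cases2) (use nat P_minus in auto)
  qed
  have P_gcd: "gcd p q \<in> P" if "p \<in> P" "q \<in> P" for p q :: int
  proof -
    obtain u v where "u * p + v * q = gcd p q" using bezout_int by blast
    moreover have "p * u + q * v \<in> P" using that P_mult P_add by blast
    ultimately show ?thesis by (simp add: mult.commute)
  qed
  have "Gcd ((*) (int N ^ n) ` F) \<in> P" if "finite F" "F \<subseteq> E" for F
    using that
  proof (induction F rule: finite_induct)
    case (insert e F)
    have "e \<in> J" using insert.prems digits_subset_J[of 1] by auto
    then have "int N ^ n * e \<in> P" using per unfolding P_def by blast
    then show ?case using insert P_gcd by simp
  qed (simp add: P0)
  then have "Gcd ((*) (int N ^ n) ` E) \<in> P" using finite_E by blast
  then have "int N ^ n \<in> P" using gcd by (simp add: Gcd_mult)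
  then have "int N ^ n * w \<in> P" for w by (rule P_mult)
  then show ?thesis using that n unfolding P_def by blast
qed

text \<open>With \<open>M = N\<^sup>n\<close> a period, let \<open>A\<close> be the residues of \<open>J\<close> modulo \<open>M\<close>, so \<open>J = A \<oplus> M \<int>\<close>.
  For \<open>a \<in> A\<close> and any integer \<open>z\<close> the element \<open>a + M z\<close> of \<open>J = digits n \<oplus> M J\<close> is uniquely
  \<open>(a + M \<beta>) + M x\<close>, that is, \<open>z = \<beta> + x\<close> with \<open>\<beta> \<in> B\<^sub>a\<close> and \<open>x \<in> A \<oplus> M \<int>\<close>.\<close>

lemma digits_skew_product_form:
  assumes gcd: "Gcd E = 1"
  obtains n where "n \<ge> 1" "skew_product_form (N ^ n) (digits n)"
proof -
  obtain n where n: "n \<ge> 1" and per: "\<And>x w. x + int N ^ n * w \<in> J \<longleftrightarrow> x \<in> J"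
    using J_periodic[OF gcd] by metis
  define M where "M = int N ^ n"
  have M: "M > 0" unfolding M_def using N by simp
  have per: "x + M * w \<in> J \<longleftrightarrow> x \<in> J" for x w using per unfolding M_def .
  define A where "A = J \<inter> {0..<M}"
  define s where "s = card A"
  have "finite A" unfolding A_def by simp
  then obtain a where "bij_betw a {0..<s} A" unfolding s_def using ex_bij_betw_nat_finite by blast
  then have a: "inj_on a {..<s}" "a ` {..<s} = A"
    unfolding bij_betw_def by (simp_all add: atLeast0LessThan)
  define B where "B j = {\<beta>. a j + M * \<beta> \<in> digits n}" for j
  have J_mod: "x mod M \<in> A" if "x \<in> J" for x
  proof -
    have "x mod M + M * (x div M) \<in> J" using that by simp
    then have "x mod M \<in> J" using per by blast
    then show ?thesis unfolding A_def using M by simp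
  qed
  have B: "digits n = (\<Union>j<s. a j +o (M *o B j))"
  proof (intro set_eqI iffI)
    fix e assume e: "e \<in> digits n"
    then have "e mod M \<in> a ` {..<s}" using J_mod digits_subset_J a by blast
    then obtain j where j: "j < s" "a j = e mod M" by auto
    then have eq: "a j + M * (e div M) = e" by simp
    then have "e div M \<in> B j" unfolding B_def using e by simp
    then have "a j + M * (e div M) \<in> a j +o (M *o B j)"
      by (intro set_plus_intro2 set_times_intro2)
    then have "e \<in> a j +o (M *o B j)" unfolding eq .
    then show "e \<in> (\<Union>j<s. a j +o (M *o B j))" using j by blast
  qed (auto simp: B_def elt_set_plus_def elt_set_times_def)
  have unique: "\<beta> = \<beta>' \<and> x = x'"
    if "\<beta> \<in> B j" "\<beta>' \<in> B j" "x \<in> J" "x' \<in> J" "\<beta> + x = \<beta>' + x'" for j \<beta> \<beta>' x x'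
  proof -
    have "a j + M * \<beta> + M * x = a j + M * \<beta>' + M * x'"
      using that(5) by (metis add.assoc distrib_left)
    then have "a j + M * \<beta> = a j + M * \<beta>' \<and> x = x'"
      using that J_decompose_unique unfolding B_def M_def by blast
    then show ?thesis using M by simp
  qed
  have unique_mod: "\<beta> = \<beta>' \<and> x = x'"
    if h: "\<beta> \<in> B j" "\<beta>' \<in> B j" "x \<in> A" "x' \<in> A" "(x + \<beta>) mod M = (x' + \<beta>') mod M" for j \<beta> \<beta>' x x'
  proof -
    obtain w where w: "x + \<beta> = x' + \<beta>' + M * w"
      using h(5) by (metis mod_eqE)
    have "x' + M * w \<in> J" using h(4) per unfolding A_def by blast
    then have *: "\<beta> = \<beta>'" "x = x' + M * w"
      using unique[of \<beta> j \<beta>' x "x' + M * w"] h w unfolding A_def by auto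
    then have "x mod M = x' mod M" by simp
    moreover have "x mod M = x" "x' mod M = x'" using h(3,4) unfolding A_def by simp_all
    ultimately show ?thesis using *(1) by simp
  qed
  have dir: "direct_sum (a ` {..<s}) (B j)" for j
    unfolding direct_sum_def a(2) inj_on_def using unique_mod by fastforce
  have crs: "complete_residue_set (N ^ n) (a ` {..<s} + B j)" if j: "j < s" for j
  proof -
    have "(\<lambda>\<beta>. a j + M * \<beta>) ` B j \<subseteq> digits n" unfolding B_def by auto
    moreover have "inj_on (\<lambda>\<beta>. a j + M * \<beta>) (B j)" using M by (auto simp: inj_on_def)
    ultimately have "finite (B j)" using finite_digits inj_on_finite by blast
    then have fin: "finite (A + B j)" using \<open>finite A\<close> by (rule finite_set_plus[rotated])
    have inj: "inj_on (\<lambda>x. x mod M) (A + B j)"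
      unfolding inj_on_def set_plus_def using unique_mod by blast
    have "(\<lambda>x. x mod M) ` (A + B j) = {0..<M}"
    proof (intro equalityI subsetI)
      fix z assume z: "z \<in> {0..<M}"
      have "a j \<in> J" using j a(2) unfolding A_def by blast
      then have "a j + M * z \<in> J" using per by blast
      then obtain e x where e: "e \<in> digits n" "x \<in> J" "a j + M * z = e + M * x"
        using J_decompose[of _ n] unfolding M_def by metis
      then have "e = a j + M * (z - x)" by (simp add: algebra_simps)
      then have "z - x \<in> B j" unfolding B_def using e by simp
      then have "x mod M + (z - x) \<in> A + B j" using J_mod[OF e(2)] by blast
      moreover have "(x mod M + (z - x)) mod M = z" using z by (simp add: mod_simps)
      ultimately show "z \<in> (\<lambda>x. x mod M) ` (A + B j)" by (metis imageI)
    qed (use M in auto)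
    then have "card (A + B j) = N ^ n"
      using card_image[OF inj] unfolding M_def by (simp add: nat_power_eq)
    then show ?thesis
      unfolding complete_residue_set_def a(2) using fin inj unfolding inj_on_def M_def by auto
  qed
  have "skew_product_form (N ^ n) (digits n)"
    unfolding skew_product_form_def
    using finite_digits card_digits a(1) B dir crs unfolding M_def by (metis of_nat_power)
  then show ?thesis using that n by blast
qed

end

section \<open>Tiles give skew-product-form digit sets\<close>

lemma skew_product_form_translate:
  assumes "skew_product_form N E"
  shows "skew_product_form N ((\<lambda>x. x + c) ` E)"
proof -
  obtain s :: nat and a :: "nat \<Rightarrow> int" and B :: "nat \<Rightarrow> int set" where
    E: "finite E" "card E = N" "inj_on a {..<s}" "E = (\<Union>j<s. a j +o (int N *o B j))"
    and B: "\<And>j. j < s \<Longrightarrow> direct_sum (a ` {..<s}) (B j) \<and> complete_residue_set N (a ` {..<s} + B j)"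
    using assms unfolding skew_product_form_def by blast
  define a' where "a' j = a j + c" for j
  have im: "a' ` {..<s} = (\<lambda>x. x + c) ` a ` {..<s}" unfolding a'_def by (simp add: image_image)
  have plus: "(\<lambda>x. x + c) ` A + C = (\<lambda>x. x + c) ` (A + C)" for A C :: "int set"
  proof (intro set_eqI)
    fix x
    have "x \<in> (\<lambda>x. x + c) ` A + C \<longleftrightarrow> (\<exists>u\<in>A. \<exists>v\<in>C. x = u + c + v)"
      by (auto simp: set_plus_def)
    also have "\<dots> \<longleftrightarrow> (\<exists>u\<in>A. \<exists>v\<in>C. x = u + v + c)" by (simp add: ac_simps)
    also have "\<dots> \<longleftrightarrow> x \<in> (\<lambda>x. x + c) ` (A + C)" by (auto simp: set_plus_def)
    finally show "x \<in> (\<lambda>x. x + c) ` A + C \<longleftrightarrow> x \<in> (\<lambda>x. x + c) ` (A + C)" .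
  qed
  have inj: "inj_on a' {..<s}" using E(3) unfolding a'_def inj_on_def by simp
  have coset: "d +o A = (+) d ` A" for d :: int and A by (auto simp: elt_set_plus_def)
  have union: "(\<lambda>x. x + c) ` E = (\<Union>j<s. a' j +o (int N *o B j))"
    unfolding E(4) a'_def image_UN coset image_image by (simp add: ac_simps)
  have dir: "direct_sum (a' ` {..<s}) (B j)" if "j < s" for j
    using B[OF that] unfolding im direct_sum_def inj_on_def by (auto simp: algebra_simps)
  have crs: "complete_residue_set N (a' ` {..<s} + B j)" if "j < s" for j
  proof -
    let ?R = "a ` {..<s} + B j"
    have R: "finite ?R" "card ?R = N"
      "\<And>x y. x \<in> ?R \<Longrightarrow> y \<in> ?R \<Longrightarrow> x mod int N = y mod int N \<Longrightarrow> x = y"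
      using B[OF that] unfolding complete_residue_set_def by blast+
    have "card ((\<lambda>x. x + c) ` ?R) = N"
      unfolding R(2)[symmetric] by (intro card_image) (simp add: inj_on_def)
    moreover have "(x + c) mod int N \<noteq> (y + c) mod int N"
      if "x \<in> ?R" "y \<in> ?R" "x + c \<noteq> y + c" for x y
      using R(3)[OF that(1,2)] that(3) mod_diff_cong[of "x + c" "int N" "y + c" c c] by auto
    ultimately show ?thesis
      using R(1) unfolding im plus complete_residue_set_def by blast
  qed
  have "card ((\<lambda>x. x + c) ` E) = N"
    using E(2) by (subst card_image) (simp_all add: inj_on_def)
  then show ?thesis
    unfolding skew_product_form_def using E(1) inj union dir crs by blast
qed

text \<open>The origin is moved into the interior.  If \<open>N = b\<^sup>l\<close> and \<open>x\<close> is an interior point of \<open>T\<close>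
  lying in the cell \<open>N\<^sup>-\<^sup>1 (T + y)\<close>, then the point \<open>t = y / (N - 1)\<close> fixed by \<open>u \<mapsto> N\<^sup>-\<^sup>1 (u + y)\<close>
  satisfies \<open>t - x = (x - x') / (N - 1)\<close> with \<open>x' \<in> T\<close>, so \<open>t\<close> is interior too when \<open>l\<close> is large.
  The equation \<open>N t - y = t\<close> says that \<open>T - t\<close> has the integer digit set \<open>D\<^sub>l - y\<close>, which
  contains \<open>0\<close> and again has greatest common divisor \<open>1\<close>.\<close>

lemma tile_centered:
  assumes b: "b \<ge> 2" and D: "finite D" "card D = b" "0 \<in> D" "Gcd D = 1"
    and T: "compact T" "self_replicating b D T" "interior T \<noteq> {}"
  obtains l c S where "l \<ge> 1" "centered_tile (b ^ l) ((\<lambda>d. d + c) ` iterated_digits b D l) S"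
    "Gcd ((\<lambda>d. d + c) ` iterated_digits b D l) = 1"
proof -
  obtain x r where r: "r > 0" "ball x r \<subseteq> T" "x \<in> T"
    using T(3) by (metis all_not_in_conv mem_interior interior_subset subsetD)
  obtain C where C: "\<And>s. s \<in> T \<Longrightarrow> \<bar>s\<bar> \<le> C"
    using compact_imp_bounded[OF T(1)] by (auto simp: bounded_iff)
  obtain k where k: "2 * C / r + 1 < real b ^ k" using real_arch_pow[of "real b"] b by fastforce
  define l where "l = Suc k"
  have "real b ^ k \<le> real b ^ l" unfolding l_def using b by simp
  then have l: "l \<ge> 1" "2 * C / r < real b ^ l - 1" unfolding l_def using k by auto
  have bl: "b ^ l \<ge> 2" using self_le_power[of b l] b l(1) by simp
  then have "real (b ^ l) \<ge> real 2" by (simp only: of_nat_le_iff)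
  then have bl1: "real b ^ l - 1 > 0" by simp
  obtain y where y: "y \<in> iterated_digits b D l" "real b ^ l * x - of_int y \<in> T"
    using self_replicatingD[OF T(2) r(3)] by blast
  define t where "t = of_int y / (real b ^ l - 1)"
  have t: "real b ^ l * t - of_int y = t" unfolding t_def using bl1 by (simp add: field_simps)
  have "t \<in> interior T"
  proof -
    have "t - x = (x - (real b ^ l * x - of_int y)) / (real b ^ l - 1)"
      unfolding t_def using bl1 by (simp add: field_simps)
    then have "\<bar>t - x\<bar> = \<bar>x - (real b ^ l * x - of_int y)\<bar> / (real b ^ l - 1)"
      using bl1 by simp
    also have "\<dots> \<le> 2 * C / (real b ^ l - 1)"
      using C[OF r(3)] C[OF y(2)] bl1 by (intro divide_right_mono) linarith+
    also have "\<dots> < r" using l(2) r(1) bl1 by (simp add: field_simps)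
    finally have "t \<in> ball x r" by (simp add: dist_real_def abs_minus_commute)
    then show ?thesis using r(2) interiorI by blast
  qed
  define S where "S = (+) (- t) ` T"
  define E where "E = (\<lambda>d. d + (- y)) ` iterated_digits b D l"
  have S: "u \<in> S \<longleftrightarrow> u + t \<in> T" for u
  proof
    assume "u + t \<in> T"
    then have "- t + (u + t) \<in> S" unfolding S_def by (rule imageI)
    then show "u \<in> S" by simp
  qed (auto simp: S_def)
  have "self_replicating (b ^ l) E S"
    unfolding self_replicating_def
  proof
    fix u
    have eq: "real (b ^ l) * (u + t) - of_int d = real (b ^ l) * u - of_int (d + (- y)) + t" for d
      using t by (simp add: algebra_simps)
    have "u \<in> S \<longleftrightarrow> (\<exists>d\<in>iterated_digits b D l. real (b ^ l) * (u + t) - of_int d \<in> T)"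
      using self_replicating_iterate[OF T(2), of l] unfolding S self_replicating_def by blast
    then show "u \<in> S \<longleftrightarrow> (\<exists>e\<in>E. real (b ^ l) * u - of_int e \<in> S)"
      unfolding eq E_def S by blast
  qed
  moreover have "0 \<in> interior S"
    unfolding S_def interior_translation using \<open>t \<in> interior T\<close> by (metis add.left_inverse imageI)
  moreover have "compact S" unfolding S_def using T(1) compact_translation by blast
  moreover have "finite E" unfolding E_def using finite_iterated_digits D(1) by blast
  moreover have "card E \<le> b ^ l"
    unfolding E_def using card_iterated_digits_le[of D b l] finite_iterated_digits D
    by (metis card_image_le order_trans order_refl)
  moreover have "0 \<in> E" unfolding E_def using y(1) by force
  ultimately have "centered_tile (b ^ l) E S" using bl by unfold_locales auto
  moreover have "Gcd E = 1"
  proof -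
    have "Gcd E dvd 1"
      unfolding D(4)[symmetric]
    proof (rule Gcd_greatest)
      fix d assume d: "d \<in> D"
      have "d \<in> iterated_digits b D l"
        using iterated_digits_mono[OF D(3) l(1), of b] d by auto
      then have "d + (- y) \<in> E" "0 + (- y) \<in> E"
        unfolding E_def using zero_in_iterated_digits[OF D(3)] by blast+
      then have "Gcd E dvd (d + (- y)) - (0 + (- y))" by (intro dvd_diff Gcd_dvd)
      then show "Gcd E dvd d" by simp
    qed
    then show ?thesis by simp
  qed
  ultimately show ?thesis using that l(1) unfolding E_def by blast
qed

theorem corollary1p8:
  fixes b :: nat and D :: "int set"
  assumes "b \<ge> 2" and "finite D" and "card D = b" and "0 \<in> D" and "Gcd D = 1"
  shows "self_similar_tile (attractor b D) \<longleftrightarrow>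
    (\<exists>m\<ge>1. skew_product_form (b ^ m) (iterated_digits b D m))"
proof
  note T = attractor_self_replicating[OF assms(1,2,4)]
  show "\<exists>m\<ge>1. skew_product_form (b ^ m) (iterated_digits b D m)"
    if "self_similar_tile (attractor b D)"
  proof -
    obtain l y S where l: "l \<ge> 1"
      and c: "centered_tile (b ^ l) ((\<lambda>d. d + y) ` iterated_digits b D l) S"
        "Gcd ((\<lambda>d. d + y) ` iterated_digits b D l) = 1"
      using tile_centered[OF assms T(1,3)] \<open>self_similar_tile (attractor b D)\<close>
      unfolding self_similar_tile_def by metis
    obtain n where n: "n \<ge> 1" "skew_product_form ((b ^ l) ^ n)
        (iterated_digits (b ^ l) ((\<lambda>d. d + y) ` iterated_digits b D l) n)"
      using centered_tile.digits_skew_product_form[OF c] by blast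
    define c where "c = y * (\<Sum>i<n. int (b ^ l) ^ i)"
    have "skew_product_form (b ^ (l * n)) ((\<lambda>x. x + c) ` iterated_digits b D (l * n))"
      using n(2) unfolding iterated_digits_translate iterated_digits_mult c_def power_mult .
    from skew_product_form_translate[OF this, of "- c"]
    have "skew_product_form (b ^ (l * n)) (iterated_digits b D (l * n))"
      by (simp add: image_image)
    moreover have "l * n \<ge> 1" using l n(1) by simp
    ultimately show ?thesis by blast
  qed
  show "self_similar_tile (attractor b D)"
    if "\<exists>m\<ge>1. skew_product_form (b ^ m) (iterated_digits b D m)"
  proof -
    obtain m where m: "m \<ge> 1" "skew_product_form (b ^ m) (iterated_digits b D m)"
      using \<open>\<exists>m\<ge>1. _ m\<close> by blast
    have "2 \<le> b ^ m" using assms(1) m(1) self_le_power[of b m] by simp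
    then show ?thesis
      unfolding self_similar_tile_def
      using skew_product_form_interior[OF _ m(2) T(1,2) self_replicating_iterate[OF T(3)]] by blast
  qed
qed

end
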